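(* If $L:\mathrm{Lip}(I\times J)\to\mathrm{Lip}(I\times J)$ is a closed operator (regarded as an operator with domain $\mathrm{Lip}(I\times J)\subset\mathcal{C}(I\times J)$ and values in $\mathcal{C}(I\times J)$), then the $\alpha$-fractal operator $\mathcal{F}^{\alpha}_{\Delta,L}:\mathrm{Lip}(I\times J)\subset\mathcal{C}(I\times J)\to\mathcal{C}(I\times J)$ is $L$-closed.
   Context: Let $a<b$, $c<d$, $I=[a,b]$, $J=[c,d]$, $\mathbb{N}=\{1,2,\dots\}$, $\mathbb{N}_0=\mathbb{N}\cup\{0\}$. $\mathcal{C}(I\times J)$ is the Banach space of continuous real-valued functions on $I\times J$ with sup-norm $\|\cdot\|_\infty$; $\mathrm{Lip}(I\times J)\subset\mathcal{C}(I\times J)$ is the subspace of Lipschitz functions (Euclidean norm on $\mathbb{R}^2$), equipped with the sup-norm. Partition: $\Delta=\{x_i:i\in\mathbb{N}_0\}\times\{y_j:j\in\mathbb{N}_0\}$ with $(x_i)$, $(y_j)$ strictly increasing, $x_0=a$, $y_0=c$, $x_i\to b=:x_\infty$, $y_j\to d=:y_\infty$. Put $I_i=[x_{i-1},x_i]$, $J_j=[y_{j-1},y_j]$ for $i,j\in\mathbb{N}$. Affine maps: $u_i:I\to I_i$ is the affine bijection with $u_i(a)=x_{i-1}$, $u_i(b)=x_i$ if $i$ is odd, and $u_i(a)=x_i$, $u_i(b)=x_{i-1}$ if $i$ is even; $v_j:J\to J_j$ is defined likewise with the $y_j$. Scale function: $\alpha=(\alpha_{ij})_{i,j\in\mathbb{N}}$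 is a double sequence of Lipschitz functions on $I\times J$ with uniformly bounded Lipschitz constants and $\|\alpha\|_\infty:=\sup_{i,j}\|\alpha_{ij}\|_\infty<1$. Parameter map: $L:\mathrm{Lip}(I\times J)\to\mathrm{Lip}(I\times J)$ is a (not necessarily linear) operator with $L(f)(x_k,y_l)=f(x_k,y_l)$ for all $f$ and all $k,l\in\{0,\infty\}$. $\alpha$-fractal function: for $f\in\mathrm{Lip}(I\times J)$, $f^{\alpha}_{\Delta,L}$ is the unique function in $\mathcal{C}(I\times J)$ with $f^{\alpha}_{\Delta,L}(x_k,y_l)=f(x_k,y_l)$ for $k,l\in\{0,\infty\}$ and $$f^{\alpha}_{\Delta,L}(x,y)=f(x,y)+\alpha_{ij}(x,y)\big[f^{\alpha}_{\Delta,L}(u_i^{-1}(x),v_j^{-1}(y))-L(f)(u_i^{-1}(x),v_j^{-1}(y))\big]$$ for all $(x,y)\in I_i\times J_j$, $i,j\in\mathbb{N}$ (values on $x=b$ or $y=d$ being determined by continuity). Standing assumption: the parameters $\alpha,\Delta,L$ are permissible, i.e. this function exists for every $f\in\mathrm{Lip}(I\times J)$. The $\alpha$-fractal operator is $\mathcal{F}^{\alpha}_{\Delta,L}(f)=f^{\alpha}_{\Delta,L}$. A (not necessarily linear) operator $A:D(A)\subset X\to Y$ between normed spaces is closed if, for every sequence $(x_n)$ in $D(A)$, $x_n\to x\in X$ and $A(x_n)\to y\in Y$ imply $x\in D(A)$ and $A(x)=y$. If $B:D(B)\subset X\to Y$ is another operator with $D(B)\subset D(A)$, then $A$ is $B$-closed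 if, for every sequence $(x_n)$ in $D(B)$, $x_n\to x$, $B(x_n)\to y$ and $A(x_n)\to z$ imply $x\in D(A)$ and $A(x)=z$. *)

theory Defs
  imports "HOL-Analysis.Analysis"
begin

section \<open>Closed and relatively closed operators\<close>

text \<open>
  Operators are neither assumed linear nor everywhere defined: \<open>A : D \<subseteq> M \<rightarrow> N\<close> is a function
  on the ambient type of which only the values on \<open>D\<close> matter. Of the normed spaces only the metric
  induced by the norm enters the two notions of closedness.
\<close>

definition operator_on :: "'a metric \<Rightarrow> 'b metric \<Rightarrow> 'a set \<Rightarrow> ('a \<Rightarrow> 'b) \<Rightarrow> bool" where
  "operator_on M N D A \<longleftrightarrow> D \<subseteq> mspace M \<and> A \<in> D \<rightarrow> mspace N"

definition closed_operator :: "'a metric \<Rightarrow> 'b metric \<Rightarrow> 'a set \<Rightarrow> ('a \<Rightarrow> 'b) \<Rightarrow> bool" where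
  "closed_operator M N D A \<longleftrightarrow> operator_on M N D A \<and>
     (\<forall>\<xi> x y. (\<forall>n::nat. \<xi> n \<in> D) \<and>
        limitin (mtopology_of M) \<xi> x sequentially \<and>
        limitin (mtopology_of N) (\<lambda>n. A (\<xi> n)) y sequentially
        \<longrightarrow> x \<in> D \<and> A x = y)"

text \<open>\<open>relatively_closed_operator M N D A D' B\<close>: the operator \<open>A\<close> with domain \<open>D\<close> is
  \<open>B\<close>-closed, where \<open>B\<close> has domain \<open>D' \<subseteq> D\<close>.\<close>

definition relatively_closed_operator ::
  "'a metric \<Rightarrow> 'b metric \<Rightarrow> 'a set \<Rightarrow> ('a \<Rightarrow> 'b) \<Rightarrow> 'a set \<Rightarrow> ('a \<Rightarrow> 'b) \<Rightarrow> bool" where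
  "relatively_closed_operator M N D A D' B \<longleftrightarrow>
     operator_on M N D A \<and> operator_on M N D' B \<and> D' \<subseteq> D \<and>
     (\<forall>\<xi> x y z. (\<forall>n::nat. \<xi> n \<in> D') \<and>
        limitin (mtopology_of M) \<xi> x sequentially \<and>
        limitin (mtopology_of N) (\<lambda>n. B (\<xi> n)) y sequentially \<and>
        limitin (mtopology_of N) (\<lambda>n. A (\<xi> n)) z sequentially
        \<longrightarrow> x \<in> D \<and> A x = z)"

section \<open>The function spaces\<close>

text \<open>
  A function on \<open>S\<close> is represented by a function on the plane that is \<open>undefined\<close> off \<open>S\<close>
  (\<^term>\<open>extensional S\<close>), so that equality and uniqueness mean equality on \<open>S\<close>.
\<close>

definition cont_space :: "(real \<times> real) set \<Rightarrow> (real \<times> real \<Rightarrow> real) metric" where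
  "cont_space S = cfunspace (top_of_set S) euclidean_metric"

definition lip_space :: "(real \<times> real) set \<Rightarrow> (real \<times> real \<Rightarrow> real) set" where
  "lip_space S = {f \<in> mspace (cont_space S). \<exists>C. C-lipschitz_on S f}"

lemma mspace_cont_space:
  assumes "compact S"
  shows "mspace (cont_space S) = {f \<in> extensional S. continuous_on S f}"
proof -
  have "Metric_space.mbounded UNIV dist (f ` S)" if "continuous_on S f" for f :: "real \<times> real \<Rightarrow> real"
  proof -
    have "bounded (f ` S)"
      using compact_continuous_image[OF that assms] by (rule compact_imp_bounded)
    then show ?thesis
      by (auto simp: bounded_def Met_TC.mbounded_def subset_iff)
  qed
  then show ?thesis
    by (auto simp: cont_space_def)
qed

lemma mdist_cont_space:
  assumes "S \<noteq> {}" "f \<in> mspace (cont_space S)" "g \<in> mspace (cont_space S)"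
  shows "mdist (cont_space S) f g = (SUP p\<in>S. \<bar>f p - g p\<bar>)"
proof -
  have "f \<in> Metric_space.fspace UNIV dist S" "g \<in> Metric_space.fspace UNIV dist S"
    using assms cfunspace_subset_funspace[of "top_of_set S" euclidean_metric]
    unfolding cont_space_def by (auto simp del: mspace_cfunspace)
  then show ?thesis
    using assms(1)
    by (simp add: cont_space_def mdist_cfunspace_eq_mdist_funspace Met_TC.fdist_def dist_real_def)
qed

section \<open>Partition, affine maps and parameters\<close>

definition partition_seq :: "real \<Rightarrow> real \<Rightarrow> (nat \<Rightarrow> real) \<Rightarrow> bool" where
  "partition_seq a b x \<longleftrightarrow> strict_mono x \<and> x 0 = a \<and> x \<longlonglongrightarrow> b"

definition affine_from_to :: "real \<Rightarrow> real \<Rightarrow> real \<Rightarrow> real \<Rightarrow> real \<Rightarrow> real" where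
  "affine_from_to a b p q t = p + (t - a) / (b - a) * (q - p)"

text \<open>The maps \<open>u\<^sub>i\<close> (and \<open>v\<^sub>j\<close>), orientation preserving exactly for odd index.\<close>

definition part_map :: "real \<Rightarrow> real \<Rightarrow> (nat \<Rightarrow> real) \<Rightarrow> nat \<Rightarrow> real \<Rightarrow> real" where
  "part_map a b x i =
     (if odd i then affine_from_to a b (x (i - 1)) (x i) else affine_from_to a b (x i) (x (i - 1)))"

lemma part_map_endpoints:
  assumes "a < b"
  shows "part_map a b x i a = (if odd i then x (i - 1) else x i)"
    and "part_map a b x i b = (if odd i then x i else x (i - 1))"
  using assms by (auto simp: part_map_def affine_from_to_def)

definition scale_norm ::
  "(real \<times> real) set \<Rightarrow> (nat \<Rightarrow> nat \<Rightarrow> real \<times> real \<Rightarrow> real) \<Rightarrow> ereal" where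
  "scale_norm S \<alpha> = (SUP i\<in>{1..}. SUP j\<in>{1..}. SUP p\<in>S. ereal \<bar>\<alpha> i j p\<bar>)"

definition scale_function ::
  "(real \<times> real) set \<Rightarrow> (nat \<Rightarrow> nat \<Rightarrow> real \<times> real \<Rightarrow> real) \<Rightarrow> bool" where
  "scale_function S \<alpha> \<longleftrightarrow>
     (\<exists>C. \<forall>i\<ge>1. \<forall>j\<ge>1. C-lipschitz_on S (\<alpha> i j)) \<and> scale_norm S \<alpha> < 1"

text \<open>Since \<open>x\<^sub>0 = a\<close>, \<open>x\<^sub>\<infinity> = b\<close>, \<open>y\<^sub>0 = c\<close>, \<open>y\<^sub>\<infinity> = d\<close>, the points \<open>(x\<^sub>k, y\<^sub>l)\<close> with
  \<open>k, l \<in> {0, \<infinity>}\<close> are the four corners \<^term>\<open>{a, b} \<times> {c, d}\<close>.\<close>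

definition parameter_map ::
  "real \<Rightarrow> real \<Rightarrow> real \<Rightarrow> real \<Rightarrow> ((real \<times> real \<Rightarrow> real) \<Rightarrow> real \<times> real \<Rightarrow> real) \<Rightarrow> bool" where
  "parameter_map a b c d L \<longleftrightarrow>
     L \<in> lip_space ({a..b} \<times> {c..d}) \<rightarrow> lip_space ({a..b} \<times> {c..d}) \<and>
     (\<forall>f \<in> lip_space ({a..b} \<times> {c..d}). \<forall>p \<in> {a, b} \<times> {c, d}. L f p = f p)"

section \<open>The fractal operator\<close>

definition is_fractal_function ::
  "real \<Rightarrow> real \<Rightarrow> real \<Rightarrow> real \<Rightarrow> (nat \<Rightarrow> real) \<Rightarrow> (nat \<Rightarrow> real) \<Rightarrow>
   (nat \<Rightarrow> nat \<Rightarrow> real \<times> real \<Rightarrow> real) \<Rightarrow> ((real \<times> real \<Rightarrow> real) \<Rightarrow> real \<times> real \<Rightarrow> real) \<Rightarrow>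
   (real \<times> real \<Rightarrow> real) \<Rightarrow> (real \<times> real \<Rightarrow> real) \<Rightarrow> bool" where
  "is_fractal_function a b c d x y \<alpha> L f g \<longleftrightarrow>
     g \<in> mspace (cont_space ({a..b} \<times> {c..d})) \<and>
     (\<forall>p \<in> {a, b} \<times> {c, d}. g p = f p) \<and>
     (\<forall>i\<ge>1. \<forall>j\<ge>1. \<forall>s \<in> {x (i - 1)..x i}. \<forall>t \<in> {y (j - 1)..y j}.
        let q = (inv_into {a..b} (part_map a b x i) s, inv_into {c..d} (part_map c d y j) t)
        in g (s, t) = f (s, t) + \<alpha> i j (s, t) * (g q - L f q))"

definition permissible ::
  "real \<Rightarrow> real \<Rightarrow> real \<Rightarrow> real \<Rightarrow> (nat \<Rightarrow> real) \<Rightarrow> (nat \<Rightarrow> real) \<Rightarrow>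
   (nat \<Rightarrow> nat \<Rightarrow> real \<times> real \<Rightarrow> real) \<Rightarrow> ((real \<times> real \<Rightarrow> real) \<Rightarrow> real \<times> real \<Rightarrow> real) \<Rightarrow> bool" where
  "permissible a b c d x y \<alpha> L \<longleftrightarrow>
     (\<forall>f \<in> lip_space ({a..b} \<times> {c..d}). \<exists>g. is_fractal_function a b c d x y \<alpha> L f g)"

text \<open>Permissibility only requires existence; uniqueness is a consequence of
  \<open>\<parallel>\<alpha>\<parallel>\<^sub>\<infinity> < 1\<close>, so that the description below is proper for permissible parameters.\<close>

definition fractal_operator ::
  "real \<Rightarrow> real \<Rightarrow> real \<Rightarrow> real \<Rightarrow> (nat \<Rightarrow> real) \<Rightarrow> (nat \<Rightarrow> real) \<Rightarrow>
   (nat \<Rightarrow> nat \<Rightarrow> real \<times> real \<Rightarrow> real) \<Rightarrow> ((real \<times> real \<Rightarrow> real) \<Rightarrow> real \<times> real \<Rightarrow> real) \<Rightarrow>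
   (real \<times> real \<Rightarrow> real) \<Rightarrow> real \<times> real \<Rightarrow> real" where
  "fractal_operator a b c d x y \<alpha> L f = (THE g. is_fractal_function a b c d x y \<alpha> L f g)"

end

theory Submission
  imports Defs
begin

text \<open>
  Closedness of \<open>L\<close> gives \<open>L f = lim L f\<^sub>n\<close>. Uniform convergence implies pointwise convergence, so
  the limit of the fractal functions of \<open>f\<^sub>n\<close> satisfies the functional equation of \<open>f\<close>. That
  equation has at most one continuous solution: the difference \<open>D\<close> of two solutions satisfies
  \<open>\<bar>D\<bar> \<le> r \<parallel>D\<parallel>\<close> with \<open>r < 1\<close> on the dense subset \<open>[a, b) \<times> [c, d)\<close>.
\<close>

lemma partition_seq_in_interval:
  assumes "partition_seq a b x"
  shows "x n \<in> {a..b}"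
proof -
  have "incseq x" "x \<longlonglongrightarrow> b" "x 0 = a"
    using assms by (auto simp: partition_seq_def strict_mono_mono)
  then show ?thesis
    using incseq_le[of x b n] incseqD[of x 0 n] by auto
qed

text \<open>The endpoint \<open>b\<close> is only the limit of the nodes and lies in no cell, hence
  the half-open interval. The cell is found from the least \<open>i\<close> with
  \<open>s < x i\<close>; since \<open>x 0 = a\<close> and \<open>a \<le> s\<close>, this index is
  at least 1.\<close>

lemma partition_seq_cover:
  assumes "partition_seq a b x" "s \<in> {a..<b}"
  obtains i where "i \<ge> 1" "s \<in> {x (i - 1)..x i}"
proof -
  have x0: "x 0 = a" and lim: "x \<longlonglongrightarrow> b"
    using assms(1) by (auto simp: partition_seq_def)
  have "eventually (\<lambda>n. s < x n) sequentially"
    using order_tendstoD(1)[OF lim] assms(2) by auto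
  then have ex: "\<exists>n. s < x n"
    by (auto simp: eventually_sequentially)
  define i where "i = (LEAST n. s < x n)"
  have less: "s < x i"
    unfolding i_def by (rule LeastI_ex[OF ex])
  have pos: "i \<ge> 1"
    using less x0 assms(2) by (cases i) auto
  have "\<not> s < x (i - 1)"
    using not_less_Least[of "i - 1" "\<lambda>n. s < x n"] pos unfolding i_def by auto
  with less pos show thesis
    by (intro that[of i]) auto
qed

text \<open>The preimage of \<open>s\<close> is given by the inverse affine map, which is
  \<open>affine_from_to\<close> with the two intervals exchanged. No order between \<open>p\<close>
  and \<open>q\<close> is fixed, so that one statement serves both orientations.\<close>

lemma affine_from_to_surj:
  assumes "a < b" "p \<noteq> q" "min p q \<le> s" "s \<le> max p q"
  shows "s \<in> affine_from_to a b p q ` {a..b}"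
proof (rule image_eqI)
  show "s = affine_from_to a b p q (affine_from_to p q a b s)"
    using assms by (simp add: affine_from_to_def)
  have "0 \<le> (s - p) / (q - p)" "(s - p) / (q - p) \<le> 1"
    using assms by (auto simp: field_simps min_def max_def split: if_splits)
  then have "0 \<le> (s - p) / (q - p) * (b - a)" "(s - p) / (q - p) * (b - a) \<le> 1 * (b - a)"
    using assms(1) by (intro mult_nonneg_nonneg mult_right_mono; simp)+
  then show "affine_from_to p q a b s \<in> {a..b}"
    by (auto simp: affine_from_to_def)
qed

text \<open>\<open>inv_into\<close> returns a genuine preimage only on the range of the map;
  surjectivity onto the cell ensures this and keeps the rescaled argument inside the domain of the
  functions.\<close>

lemma inv_into_part_map:
  assumes "a < b" "partition_seq a b x" "i \<ge> 1" "s \<in> {x (i - 1)..x i}"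
  shows "inv_into {a..b} (part_map a b x i) s \<in> {a..b}"
proof (rule inv_into_into)
  have "x (i - 1) < x i"
    using assms(2,3) by (auto simp: partition_seq_def intro: strict_monoD)
  then have "s \<in> affine_from_to a b (x (i - 1)) (x i) ` {a..b}"
    "s \<in> affine_from_to a b (x i) (x (i - 1)) ` {a..b}"
    using assms(1,4) by (intro affine_from_to_surj; simp)+
  then show "s \<in> part_map a b x i ` {a..b}"
    by (cases "odd i") (simp_all only: part_map_def simp_thms if_True if_False)
qed

text \<open>The supremum is taken in the extended reals; density supplies a real \<open>r\<close>
  strictly between it and 1, which serves as contraction factor in real arithmetic.\<close>

lemma scale_function_bound:
  assumes "scale_function S \<alpha>"
  obtains r where "r < 1" "\<And>i j p. i \<ge> 1 \<Longrightarrow> j \<ge> 1 \<Longrightarrow> p \<in> S \<Longrightarrow> \<bar>\<alpha> i j p\<bar> \<le> r"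
proof -
  have "scale_norm S \<alpha> < 1"
    using assms by (simp add: scale_function_def)
  then obtain r where r: "scale_norm S \<alpha> < ereal r" "ereal r < 1"
    using ereal_dense2 by blast
  have "\<bar>\<alpha> i j p\<bar> \<le> r" if "i \<ge> 1" "j \<ge> 1" "p \<in> S" for i j p
  proof -
    have "ereal \<bar>\<alpha> i j p\<bar> \<le> scale_norm S \<alpha>"
      unfolding scale_norm_def using that by (intro SUP_upper2[of i] SUP_upper2[of j] SUP_upper) auto
    with r(1) show ?thesis
      by (metis ereal_less_eq(3) less_imp_le order_trans)
  qed
  with r(2) show thesis
    by (intro that[of r]) auto
qed

lemma is_fractal_function_eq:
  assumes "is_fractal_function a b c d x y \<alpha> L f g"
    and "i \<ge> 1" "j \<ge> 1" "s \<in> {x (i - 1)..x i}" "t \<in> {y (j - 1)..y j}"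
    and "q = (inv_into {a..b} (part_map a b x i) s, inv_into {c..d} (part_map c d y j) t)"
  shows "g (s, t) = f (s, t) + \<alpha> i j (s, t) * (g q - L f q)"
  using assms unfolding is_fractal_function_def Let_def by blast

lemma is_fractal_function_unique:
  assumes ab: "a < b" and cd: "c < d"
    and x: "partition_seq a b x" and y: "partition_seq c d y"
    and \<alpha>: "scale_function ({a..b} \<times> {c..d}) \<alpha>"
    and g: "is_fractal_function a b c d x y \<alpha> L f g"
    and h: "is_fractal_function a b c d x y \<alpha> L f h"
  shows "g = h"
proof -
  define S where "S = {a..b} \<times> {c..d}"
  have S: "compact S" "S \<noteq> {}"
    using ab cd by (auto simp: S_def intro: compact_Times)
  have "g \<in> mspace (cont_space S)" "h \<in> mspace (cont_space S)"
    using g h by (simp_all add: is_fractal_function_def S_def)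
  then have ext: "g \<in> extensional S" "h \<in> extensional S"
    and cont: "continuous_on S (\<lambda>p. g p - h p)"
    by (auto simp: mspace_cont_space[OF S(1)] intro: continuous_intros)
  \<comment> \<open>By compactness the sup-norm of \<open>g - h\<close> is attained, so it can be
    handled as the value at \<open>p\<close>.\<close>
  obtain p where p: "p \<in> S" and max: "\<And>q. q \<in> S \<Longrightarrow> \<bar>g q - h q\<bar> \<le> \<bar>g p - h p\<bar>"
    using continuous_attains_sup[OF S continuous_on_rabs[OF cont]] by blast
  obtain r where r: "r < 1" "\<And>i j q. i \<ge> 1 \<Longrightarrow> j \<ge> 1 \<Longrightarrow> q \<in> S \<Longrightarrow> \<bar>\<alpha> i j q\<bar> \<le> r"
    using scale_function_bound[OF \<alpha>] unfolding S_def by blast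
  \<comment> \<open>The functional equation speaks only about cells, and these do not reach the
    edges at \<open>b\<close> and \<open>d\<close>; the bound is therefore first shown off these
    edges.\<close>
  have contr: "norm (g q - h q) \<le> r * \<bar>g p - h p\<bar>" if "q \<in> {a..<b} \<times> {c..<d}" for q
  proof -
    obtain s t where q: "q = (s, t)" "s \<in> {a..<b}" "t \<in> {c..<d}"
      using \<open>q \<in> {a..<b} \<times> {c..<d}\<close> by (rule SigmaE)
    obtain i where i: "i \<ge> 1" "s \<in> {x (i - 1)..x i}"
      using partition_seq_cover[OF x q(2)] .
    obtain j where j: "j \<ge> 1" "t \<in> {y (j - 1)..y j}"
      using partition_seq_cover[OF y q(3)] .
    define q' where "q' = (inv_into {a..b} (part_map a b x i) s, inv_into {c..d} (part_map c d y j) t)"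
    have "q' \<in> S"
      using inv_into_part_map[OF ab x i] inv_into_part_map[OF cd y j] by (simp add: q'_def S_def)
    \<comment> \<open>Both solutions belong to the same \<open>f\<close>, so the terms
      \<open>f q\<close> and \<open>L f q'\<close> cancel.\<close>
    have "g q - h q = \<alpha> i j q * (g q' - h q')"
      using is_fractal_function_eq[OF g i(1) j(1) i(2) j(2) q'_def]
        is_fractal_function_eq[OF h i(1) j(1) i(2) j(2) q'_def]
      by (simp add: q(1) algebra_simps)
    moreover have "\<bar>\<alpha> i j q\<bar> \<le> r"
      using q by (intro r(2) i j) (auto simp: S_def)
    ultimately show ?thesis
      using max[OF \<open>q' \<in> S\<close>] by (auto simp: abs_mult intro!: mult_mono)
  qed
  have closure: "closure ({a..<b} \<times> {c..<d}) = S"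
    using ab cd by (simp add: S_def closure_Times)
  \<comment> \<open>The maximum point may lie on an edge outside all cells; continuity carries the
    bound over to the closure.\<close>
  have "norm (g p - h p) \<le> r * \<bar>g p - h p\<bar>"
    using continuous_on_closure_norm_le[of "{a..<b} \<times> {c..<d}" "\<lambda>q. g q - h q"] cont contr p
    unfolding closure by blast
  then have "(1 - r) * \<bar>g p - h p\<bar> \<le> 0"
    by (simp add: algebra_simps)
  then have "\<bar>g p - h p\<bar> = 0"
    using r(1) by (simp add: mult_le_0_iff)
  with max have "g q = h q" if "q \<in> S" for q
    using that by fastforce
  \<comment> \<open>Agreement on \<open>S\<close> gives equality of functions because both are
    \<open>undefined\<close> elsewhere.\<close>
  then show ?thesis
    using ext by (intro extensionalityI)
qed

text \<open>Uniqueness makes the description \<open>THE\<close> pick out any solution at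
  hand.\<close>

lemma fractal_operator_eqI:
  assumes "a < b" "c < d" "partition_seq a b x" "partition_seq c d y"
    and "scale_function ({a..b} \<times> {c..d}) \<alpha>"
    and "is_fractal_function a b c d x y \<alpha> L f g"
  shows "fractal_operator a b c d x y \<alpha> L f = g"
  unfolding fractal_operator_def
  using assms is_fractal_function_unique[OF assms(1-5)] by (intro the_equality) blast+

lemma is_fractal_function_fractal_operator:
  assumes "a < b" "c < d" "partition_seq a b x" "partition_seq c d y"
    and "scale_function ({a..b} \<times> {c..d}) \<alpha>"
    and "permissible a b c d x y \<alpha> L" "f \<in> lip_space ({a..b} \<times> {c..d})"
  shows "is_fractal_function a b c d x y \<alpha> L f (fractal_operator a b c d x y \<alpha> L f)"
proof -
  obtain g where "is_fractal_function a b c d x y \<alpha> L f g"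
    using assms(6,7) unfolding permissible_def by blast
  with fractal_operator_eqI[OF assms(1-5) this] show ?thesis
    by simp
qed

text \<open>The distance of two values at a point is at most the sup-distance of the
  functions.\<close>

lemma limitin_cont_space_pointwise:
  assumes lim: "limitin (mtopology_of (cont_space S)) \<xi> f sequentially" and p: "p \<in> S"
  shows "(\<lambda>n. \<xi> n p) \<longlonglongrightarrow> f p"
proof (rule tendstoI)
  fix e :: real
  assume "e > 0"
  with lim have f: "f \<in> mspace (cont_space S)"
    and "eventually (\<lambda>n. \<xi> n \<in> mspace (cont_space S) \<and> mdist (cont_space S) (\<xi> n) f < e) sequentially"
    by (auto simp: mtopology_of_def Metric_space.limitin_metric[OF Metric_space_mspace_mdist])
  then show "eventually (\<lambda>n. dist (\<xi> n p) (f p) < e) sequentially"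
  proof (rule_tac eventually_mono)
    fix n
    assume n: "\<xi> n \<in> mspace (cont_space S) \<and> mdist (cont_space S) (\<xi> n) f < e"
    have "dist (\<xi> n p) (f p) \<le> mdist (cont_space S) (\<xi> n) f"
      using mdist_cfunspace_imp_mdist_le[of "\<xi> n" "top_of_set S" euclidean_metric f _ p] n f p
      unfolding cont_space_def by fastforce
    with n show "dist (\<xi> n p) (f p) < e"
      by simp
  qed
qed

text \<open>Each condition compares values at finitely many points that do not depend on
  \<open>n\<close>, so it survives pointwise limits. The hypothesis that \<open>L (\<xi> n)\<close>
  tends to \<open>L f\<close> itself is what puts \<open>L f\<close> into the limit
  equation.\<close>

lemma is_fractal_function_limit:
  assumes ab: "a < b" and cd: "c < d"
    and x: "partition_seq a b x" and y: "partition_seq c d y"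
    and frac: "\<And>n. is_fractal_function a b c d x y \<alpha> L (\<xi> n) (\<gamma> n)"
    and f: "limitin (mtopology_of (cont_space ({a..b} \<times> {c..d}))) \<xi> f sequentially"
    and Lf: "limitin (mtopology_of (cont_space ({a..b} \<times> {c..d}))) (\<lambda>n. L (\<xi> n)) (L f) sequentially"
    and g: "limitin (mtopology_of (cont_space ({a..b} \<times> {c..d}))) \<gamma> g sequentially"
  shows "is_fractal_function a b c d x y \<alpha> L f g"
  unfolding is_fractal_function_def Let_def
proof (intro conjI ballI allI impI)
  note lims = limitin_cont_space_pointwise[OF f] limitin_cont_space_pointwise[OF Lf]
    limitin_cont_space_pointwise[OF g]
  show "g \<in> mspace (cont_space ({a..b} \<times> {c..d}))"
    using limitin_topspace[OF g] by simp
  show "g p = f p" if p: "p \<in> {a, b} \<times> {c, d}" for p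
  proof (rule LIMSEQ_unique)
    have "p \<in> {a..b} \<times> {c..d}"
      using p ab cd by auto
    moreover have "\<gamma> n p = \<xi> n p" for n
      using frac[of n] p unfolding is_fractal_function_def by blast
    ultimately show "(\<lambda>n. \<gamma> n p) \<longlonglongrightarrow> g p" "(\<lambda>n. \<gamma> n p) \<longlonglongrightarrow> f p"
      using lims[of p] by simp_all
  qed
  fix i j s t
  assume ij: "1 \<le> i" "1 \<le> j" and st: "s \<in> {x (i - 1)..x i}" "t \<in> {y (j - 1)..y j}"
  \<comment> \<open>This point depends on the partition and on \<open>(s, t)\<close> alone, so the
    same \<open>q\<close> serves for every \<open>n\<close>.\<close>
  define q where "q = (inv_into {a..b} (part_map a b x i) s, inv_into {c..d} (part_map c d y j) t)"
  have q: "q \<in> {a..b} \<times> {c..d}"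
    using inv_into_part_map[OF ab x ij(1) st(1)] inv_into_part_map[OF cd y ij(2) st(2)]
    by (simp add: q_def)
  have p: "(s, t) \<in> {a..b} \<times> {c..d}"
    using st partition_seq_in_interval[OF x, of i] partition_seq_in_interval[OF x, of "i - 1"]
      partition_seq_in_interval[OF y, of j] partition_seq_in_interval[OF y, of "j - 1"] by auto
  have "\<gamma> n (s, t) = \<xi> n (s, t) + \<alpha> i j (s, t) * (\<gamma> n q - L (\<xi> n) q)" for n
    using is_fractal_function_eq[OF frac ij st q_def] .
  then have "(\<lambda>n. \<gamma> n (s, t)) \<longlonglongrightarrow> f (s, t) + \<alpha> i j (s, t) * (g q - L f q)"
    using lims(1)[OF p] lims(2,3)[OF q] by (auto intro!: tendsto_intros)
  then have "g (s, t) = f (s, t) + \<alpha> i j (s, t) * (g q - L f q)"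
    using lims(3)[OF p] LIMSEQ_unique by blast
  then show "g (s, t) = f (s, t) + \<alpha> i j (s, t) *
      (g (inv_into {a..b} (part_map a b x i) s, inv_into {c..d} (part_map c d y j) t) -
       L f (inv_into {a..b} (part_map a b x i) s, inv_into {c..d} (part_map c d y j) t))"
    by (simp add: q_def)
qed

theorem proposition4p31:
  fixes a b c d :: real
    and x y :: "nat \<Rightarrow> real"
    and \<alpha> :: "nat \<Rightarrow> nat \<Rightarrow> real \<times> real \<Rightarrow> real"
    and L :: "(real \<times> real \<Rightarrow> real) \<Rightarrow> real \<times> real \<Rightarrow> real"
  assumes "a < b" and "c < d"
    and "partition_seq a b x" and "partition_seq c d y"
    and "scale_function ({a..b} \<times> {c..d}) \<alpha>"
    and "parameter_map a b c d L"
    and "permissible a b c d x y \<alpha> L"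
    and "closed_operator (cont_space ({a..b} \<times> {c..d})) (cont_space ({a..b} \<times> {c..d}))
           (lip_space ({a..b} \<times> {c..d})) L"
  shows "relatively_closed_operator (cont_space ({a..b} \<times> {c..d})) (cont_space ({a..b} \<times> {c..d}))
           (lip_space ({a..b} \<times> {c..d})) (fractal_operator a b c d x y \<alpha> L)
           (lip_space ({a..b} \<times> {c..d})) L"
proof -
  let ?S = "{a..b} \<times> {c..d}"
  let ?F = "fractal_operator a b c d x y \<alpha> L"
  note frac = is_fractal_function_fractal_operator[OF assms(1-5,7)]
  have L: "operator_on (cont_space ?S) (cont_space ?S) (lip_space ?S) L"
    using assms(8) by (simp add: closed_operator_def)
  \<comment> \<open>The target of the operator is the space of continuous functions; values of
    \<open>?F\<close> are not claimed to be Lipschitz.\<close>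
  have "?F f \<in> mspace (cont_space ?S)" if "f \<in> lip_space ?S" for f
    using frac[OF that] by (simp add: is_fractal_function_def)
  then have F: "operator_on (cont_space ?S) (cont_space ?S) (lip_space ?S) ?F"
    using L by (simp add: operator_on_def)
  have "f \<in> lip_space ?S \<and> ?F f = g"
    if \<xi>: "\<forall>n::nat. \<xi> n \<in> lip_space ?S"
      and f: "limitin (mtopology_of (cont_space ?S)) \<xi> f sequentially"
      and h: "limitin (mtopology_of (cont_space ?S)) (\<lambda>n. L (\<xi> n)) h sequentially"
      and g: "limitin (mtopology_of (cont_space ?S)) (\<lambda>n. ?F (\<xi> n)) g sequentially"
    for \<xi> f h g
  proof -
    \<comment> \<open>Here closedness of \<open>L\<close> enters: it puts the limit \<open>f\<close>
      into the domain and identifies \<open>h\<close> as \<open>L f\<close>, as required for passing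
      to the limit in the functional equation.\<close>
    have Lf: "f \<in> lip_space ?S" "L f = h"
      using assms(8) \<xi> f h unfolding closed_operator_def by blast+
    have "is_fractal_function a b c d x y \<alpha> L f g"
      using is_fractal_function_limit[OF assms(1-4) frac f _ g] \<xi> h Lf(2) by blast
    with Lf(1) fractal_operator_eqI[OF assms(1-5)] show ?thesis
      by blast
  qed
  with L F show ?thesis
    unfolding relatively_closed_operator_def by blast
qed

end
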